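(* Let $F_q$ be a finite field, let $\mathbf{V}_\infty$ be the countably infinite dimensional vector space over $F_q$, and let $G=\mathrm{Aut}(\mathbf{V}_\infty)=\mathrm{GL}(\mathbf{V}_\infty)$. The unique $G$-invariant Borel probability measure on the universal minimal flow $M(G)$ is not supported on the generic orbit; that is, the (unique) comeager $G$-orbit in $M(G)$ does not have full measure.
   Context: $\mathrm{Aut}(\mathbf{V}_\infty)$ is a topological group with the pointwise convergence topology (basic neighborhoods of the identity are pointwise stabilizers of finite subsets). A $G$-flow is a jointly continuous action of $G$ on a compact Hausdorff space; it is minimal if it has no proper nonempty closed $G$-invariant subset. The universal minimal flow $M(G)$ is the minimal $G$-flow, unique up to isomorphism, that admits a continuous $G$-equivariant map to every minimal $G$-flow. The generic orbit is the orbit which is comeager in $M(G)$ (unique if it exists). Known facts and concrete description of $M(G)$: Fix a linear ordering of the set $F_q$ in which $0$ is least and $1$ is second least. For a finite dimensional vector space $V$ over $F_q$ and an ordered basis $b_0,\dots,b_{n-1}$, the induced ordering of $V$ is: $x_0b_0+\cdots+x_{n-1}b_{n-1}>y_0b_0+\cdots+y_{n-1}b_{n-1}$ iff $x_\ell>y_\ell$, where $\ell$ is the least index with $x_\ell\neq y_\ell$ (so $b_0>\cdots>b_{n-1}$). An ordering of this form is called natural. Let $\mathcal{K}^*$ be the class of naturally ordered finite dimensional vector spaces over $F_q$; it is a Fraïssé class with limit $\mathbf{V}_\infty^*$. Let $X_{\mathcal{K}^*}$ be the space of linear orderings $<$ of $\mathbf{V}_\infty$ whose restriction to every finite dimensional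 subspace is natural, with topology generated by the sets $N_{\langle W,<_W\rangle}=\{<\,\in X_{\mathcal{K}^*}: <|_W\,=\,<_W\}$, $W\subset\mathbf{V}_\infty$ a finite dimensional subspace, $<_W$ a natural ordering of $W$. Then $M(G)\cong X_{\mathcal{K}^*}$ with the natural action of $G$; the generic orbit is $\{<\,\in X_{\mathcal{K}^*}: \langle\mathbf{V}_\infty,<\rangle\cong\mathbf{V}_\infty^*\}$; and there is exactly one $G$-invariant Borel probability measure $\mu$ on $X_{\mathcal{K}^*}$, given by $\mu(N_{\langle W,<_W\rangle})=1/|\mathrm{GL}(W)|$. *)

theory Defs
  imports "HOL-Probability.Probability" "HOL-Algebra.Group_Action"
begin

section \<open>Flows of a topological group\<close>

text \<open>
  A topological group is given by a group \<open>G\<close> (as in HOL-Algebra) together with a topology \<open>T\<close>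
  whose underlying set is the carrier of \<open>G\<close>; a flow is given by a topology \<open>M\<close> and the action
  \<open>\<phi>\<close> on its underlying set.
\<close>

definition flow :: "'g monoid \<Rightarrow> 'g topology \<Rightarrow> 'm topology \<Rightarrow> ('g \<Rightarrow> 'm \<Rightarrow> 'm) \<Rightarrow> bool"
  where "flow G T M \<phi> \<longleftrightarrow>
    compact_space M \<and> Hausdorff_space M \<and> group_action G (topspace M) \<phi> \<and>
    continuous_map (prod_topology T M) M (\<lambda>(g, x). \<phi> g x)"

definition minimal_flow :: "'g monoid \<Rightarrow> 'g topology \<Rightarrow> 'm topology \<Rightarrow> ('g \<Rightarrow> 'm \<Rightarrow> 'm) \<Rightarrow> bool"
  where "minimal_flow G T M \<phi> \<longleftrightarrow>
    flow G T M \<phi> \<and> topspace M \<noteq> {} \<and>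
    (\<forall>C. closedin M C \<and> C \<noteq> {} \<and> (\<forall>g\<in>carrier G. \<phi> g ` C \<subseteq> C) \<longrightarrow> C = topspace M)"

definition flow_map ::
  "'g monoid \<Rightarrow> 'm topology \<Rightarrow> ('g \<Rightarrow> 'm \<Rightarrow> 'm) \<Rightarrow> 'n topology \<Rightarrow> ('g \<Rightarrow> 'n \<Rightarrow> 'n) \<Rightarrow> ('m \<Rightarrow> 'n) \<Rightarrow> bool"
  where "flow_map G M \<phi> N \<psi> f \<longleftrightarrow>
    continuous_map M N f \<and> (\<forall>g\<in>carrier G. \<forall>x\<in>topspace M. f (\<phi> g x) = \<psi> g (f x))"

text \<open>
  One cannot quantify over types inside a formula, so the flows \<open>N\<close> below live on the fixed type
  \<open>'g set set\<close>. This is no restriction: an orbit in a minimal flow is dense, so a minimal flow has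
  at most as many points as there are sets of subsets of \<open>G\<close>.  The lemma
  \<open>universal_minimal_flowD\<close> below gives the universal property for flows on an arbitrary type.
\<close>

definition universal_minimal_flow ::
  "'g monoid \<Rightarrow> 'g topology \<Rightarrow> 'm topology \<Rightarrow> ('g \<Rightarrow> 'm \<Rightarrow> 'm) \<Rightarrow> bool"
  where "universal_minimal_flow G T M \<phi> \<longleftrightarrow>
    minimal_flow G T M \<phi> \<and>
    (\<forall>(N :: 'g set set topology) \<psi>. minimal_flow G T N \<psi> \<longrightarrow> (\<exists>f. flow_map G M \<phi> N \<psi> f))"

definition comeager_in :: "'m topology \<Rightarrow> 'm set \<Rightarrow> bool"
  where "comeager_in M S \<longleftrightarrow> S \<subseteq> topspace M \<and>
    (\<exists>\<U>. countable \<U> \<and> (\<forall>U\<in>\<U>. openin M U \<and> M closure_of U = topspace M) \<and>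
         topspace M \<inter> \<Inter>\<U> \<subseteq> S)"

definition generic_orbit :: "'g monoid \<Rightarrow> 'm topology \<Rightarrow> ('g \<Rightarrow> 'm \<Rightarrow> 'm) \<Rightarrow> 'm set \<Rightarrow> bool"
  where "generic_orbit G M \<phi> S \<longleftrightarrow> S \<in> orbits G (topspace M) \<phi> \<and> comeager_in M S"

definition invariant_borel_prob ::
  "'g monoid \<Rightarrow> 'm topology \<Rightarrow> ('g \<Rightarrow> 'm \<Rightarrow> 'm) \<Rightarrow> 'm measure \<Rightarrow> bool"
  where "invariant_borel_prob G M \<phi> \<mu> \<longleftrightarrow>
    space \<mu> = topspace M \<and> sets \<mu> = sigma_sets (topspace M) {U. openin M U} \<and>
    prob_space \<mu> \<and> (\<forall>g\<in>carrier G. distr \<mu> \<mu> (\<phi> g) = \<mu>)"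


section \<open>The general linear group of a countably infinite dimensional vector space\<close>

definition countably_infinite_dimensional :: "('k::field \<Rightarrow> 'v::ab_group_add \<Rightarrow> 'v) \<Rightarrow> bool"
  where "countably_infinite_dimensional smul \<longleftrightarrow>
    (\<exists>B. \<not> module.dependent smul B \<and> module.span smul B = UNIV \<and> infinite B \<and> countable B)"

definition GL_group :: "('k::field \<Rightarrow> 'v::ab_group_add \<Rightarrow> 'v) \<Rightarrow> ('v \<Rightarrow> 'v) monoid"
  where "GL_group smul =
    \<lparr>carrier = {g. Vector_Spaces.linear smul smul g \<and> bij g}, monoid.mult = (\<circ>), one = id\<rparr>"

text \<open>Pointwise convergence: the topology induced from the power of the discrete space.\<close>

definition GL_topology :: "('k::field \<Rightarrow> 'v::ab_group_add \<Rightarrow> 'v) \<Rightarrow> ('v \<Rightarrow> 'v) topology"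
  where "GL_topology smul =
    subtopology (product_topology (\<lambda>_. discrete_topology UNIV) UNIV) (carrier (GL_group smul))"

lemma topspace_GL_topology: "topspace (GL_topology smul) = carrier (GL_group smul)"
  by (simp add: GL_topology_def)


section \<open>The universal property for flows on an arbitrary type\<close>

lemma minimal_flow_embeds:
  fixes N :: "'n topology" and G :: "'g monoid"
  assumes T: "topspace T = carrier G" and N: "minimal_flow G T N \<psi>"
  shows "\<exists>e :: 'n \<Rightarrow> 'g set set. inj_on e (topspace N)"
proof -
  have H: "Hausdorff_space N" and ga: "group_action G (topspace N) \<psi>"
    and jc: "continuous_map (prod_topology T N) N (\<lambda>(g, x). \<psi> g x)"
    using N by (auto simp: minimal_flow_def flow_def)
  obtain p where p: "p \<in> topspace N" using N unfolding minimal_flow_def by blast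
  have cm: "continuous_map N N (\<psi> g)" if "g \<in> carrier G" for g
  proof -
    have "continuous_map N (prod_topology T N) (\<lambda>x. (g, x))"
      using that T by (simp add: continuous_map_pairwise o_def)
    from continuous_map_compose[OF this jc] show ?thesis by (simp add: o_def)
  qed
  let ?O = "(\<lambda>g. \<psi> g p) ` carrier G"
  have inv: "\<psi> g ` ?O \<subseteq> ?O" if g: "g \<in> carrier G" for g
  proof clarsimp
    fix h assume h: "h \<in> carrier G"
    interpret group G using ga by (simp add: group_action_def group_hom_def)
    have "\<psi> g (\<psi> h p) = \<psi> (g \<otimes>\<^bsub>G\<^esub> h) p"
      using group_action.composition_rule[OF ga p g h] by simp
    then show "\<psi> g (\<psi> h p) \<in> ?O" using g h by auto
  qed
  have sub: "?O \<subseteq> topspace N"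
    using group_action.element_image[OF ga _ p] by auto
  have "one G \<in> carrier G" 
    using ga by (simp add: group_action_def group_hom_def group.is_monoid monoid.one_closed)
  then have ne: "?O \<noteq> {}" by auto
  have "\<psi> g ` (N closure_of ?O) \<subseteq> N closure_of ?O" if g: "g \<in> carrier G" for g
    using continuous_map_image_closure_subset[OF cm[OF g], of ?O] closure_of_mono[OF inv[OF g], of N]
    by blast
  moreover have "N closure_of ?O \<noteq> {}" using ne sub closure_of_subset by fastforce
  ultimately have dense: "N closure_of ?O = topspace N"
    using N unfolding minimal_flow_def by (meson closedin_closure_of)
  define e :: "'n \<Rightarrow> 'g set set"
    where "e x = {A. A \<subseteq> carrier G \<and> x \<in> N closure_of ((\<lambda>g. \<psi> g p) ` A)}" for x
  have "inj_on e (topspace N)"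
  proof (rule inj_onI, rule ccontr)
    fix x y assume x: "x \<in> topspace N" and y: "y \<in> topspace N" and exy: "e x = e y" and "x \<noteq> y"
    have "\<exists>U V. openin N U \<and> openin N V \<and> x \<in> U \<and> y \<in> V \<and> disjnt U V"
      using H[unfolded Hausdorff_space_def, rule_format, of x y] x y \<open>x \<noteq> y\<close> by simp
    then obtain U V where U: "openin N U" "x \<in> U" and V: "openin N V" "y \<in> V" and d: "disjnt U V"
      by blast
    define A where "A = {g \<in> carrier G. \<psi> g p \<in> U}"
    have im: "(\<lambda>g. \<psi> g p) ` A = U \<inter> ?O" by (auto simp: A_def)
    have "x \<in> N closure_of (U \<inter> ?O)"
      unfolding in_closure_of
    proof (intro conjI allI impI)
      show "x \<in> topspace N" by (fact x)
      fix W assume W: "x \<in> W \<and> openin N W"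
      then have "openin N (W \<inter> U)" "x \<in> W \<inter> U" using U by auto
      moreover have "x \<in> N closure_of ?O" using dense x by simp
      ultimately obtain z where "z \<in> ?O" "z \<in> W \<inter> U" unfolding in_closure_of by meson
      then show "\<exists>z. z \<in> U \<inter> ?O \<and> z \<in> W" by (intro exI[of _ z]) simp
    qed
    then have "A \<in> e x" by (simp add: e_def im) (simp add: A_def)
    moreover have "A \<notin> e y"
    proof
      assume "A \<in> e y"
      then have "y \<in> N closure_of (U \<inter> ?O)" by (simp add: e_def im)
      then obtain z where "z \<in> U" "z \<in> V" using V unfolding in_closure_of by blast
      then show False using d by (auto simp: disjnt_def)
    qed
    ultimately show False using exy by simp
  qed
  then show ?thesis by blast
qed

lemma minimal_flow_transport:
  fixes N :: "'n topology" and N' :: "'o topology" and G :: "'g monoid"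
  assumes N: "minimal_flow G T N \<psi>" and T: "topspace T = carrier G"
    and e: "homeomorphic_maps N N' e d"
  shows "minimal_flow G T N' (\<lambda>g. \<lambda>y\<in>topspace N'. e (\<psi> g (d y)))" (is "minimal_flow G T N' ?\<psi>")
proof -
  have cp: "compact_space N" and H: "Hausdorff_space N" and ga: "group_action G (topspace N) \<psi>"
    and jc: "continuous_map (prod_topology T N) N (\<lambda>(g, x). \<psi> g x)"
    and ne: "topspace N \<noteq> {}"
    and mn: "\<And>C. closedin N C \<Longrightarrow> C \<noteq> {} \<Longrightarrow> (\<forall>g\<in>carrier G. \<psi> g ` C \<subseteq> C) \<Longrightarrow> C = topspace N"
    using N unfolding minimal_flow_def flow_def by blast+
  have ce: "continuous_map N N' e" and cd: "continuous_map N' N d"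
    and de: "\<And>x. x \<in> topspace N \<Longrightarrow> d (e x) = x" and ed: "\<And>y. y \<in> topspace N' \<Longrightarrow> e (d y) = y"
    using e unfolding homeomorphic_maps_def by auto
  have em: "\<And>x. x \<in> topspace N \<Longrightarrow> e x \<in> topspace N'"
    and dm: "\<And>y. y \<in> topspace N' \<Longrightarrow> d y \<in> topspace N"
    using ce cd by (auto simp: continuous_map_def)
  have pm: "\<And>g x. g \<in> carrier G \<Longrightarrow> x \<in> topspace N \<Longrightarrow> \<psi> g x \<in> topspace N"
    using group_action.element_image[OF ga] by auto
  have hs: "N homeomorphic_space N'" using e homeomorphic_space_def by blast
  have grp: "group G" using ga by (simp add: group_action_def group_hom_def)
  have Bij: "?\<psi> g \<in> Bij (topspace N')" if g: "g \<in> carrier G" for g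
  proof -
    have i: "inv\<^bsub>G\<^esub> g \<in> carrier G" using g grp by simp
    have c1: "\<psi> (inv\<^bsub>G\<^esub> g) (\<psi> g x) = x" if "x \<in> topspace N" for x
      using group_action.orbit_sym_aux[OF ga g that refl] .
    have c2: "\<psi> g (\<psi> (inv\<^bsub>G\<^esub> g) x) = x" if "x \<in> topspace N" for x
      using group_action.orbit_sym_aux[OF ga i that refl] g grp by simp
    have "bij_betw (\<lambda>y. e (\<psi> g (d y))) (topspace N') (topspace N')"
      by (rule bij_betw_byWitness[where f' = "\<lambda>y. e (\<psi> (inv\<^bsub>G\<^esub> g) (d y))"])
        (auto simp: de ed em dm pm g i c1 c2)
    then show ?thesis by (simp add: Bij_def cong: bij_betw_cong)
  qed
  have mult: "?\<psi> (g \<otimes>\<^bsub>G\<^esub> h) = compose (topspace N') (?\<psi> g) (?\<psi> h)"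
    if "g \<in> carrier G" "h \<in> carrier G" for g h
    using that
    by (auto simp: compose_def restrict_def fun_eq_iff em dm pm de
        group_action.composition_rule[OF ga])
  have ga': "group_action G (topspace N') ?\<psi>"
    unfolding group_action_def group_hom_def group_hom_axioms_def
    using grp group_BijGroup by (auto simp: hom_def BijGroup_def Bij mult)
  have jc': "continuous_map (prod_topology T N') N' (\<lambda>(g, y). ?\<psi> g y)"
  proof -
    have "continuous_map (prod_topology T N') (prod_topology T N) (\<lambda>z. (fst z, d (snd z)))"
      using continuous_map_compose[OF continuous_map_snd cd, of T]
      by (simp add: continuous_map_pairwise o_def continuous_map_fst)
    from continuous_map_compose[OF continuous_map_compose[OF this jc] ce]
    show ?thesis by (rule continuous_map_eq) (auto simp: case_prod_beta)
  qed
  have mn': "C = topspace N'"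
    if C: "closedin N' C" "C \<noteq> {}" "\<forall>g\<in>carrier G. ?\<psi> g ` C \<subseteq> C" for C
  proof -
    have Cs: "C \<subseteq> topspace N'" using C closedin_subset by blast
    have "closedin N {x \<in> topspace N. e x \<in> C}"
      using closedin_continuous_map_preimage[OF ce C(1)] .
    moreover have "{x \<in> topspace N. e x \<in> C} \<noteq> {}"
      using C(2) Cs ed dm by fastforce
    moreover have "\<psi> g ` {x \<in> topspace N. e x \<in> C} \<subseteq> {x \<in> topspace N. e x \<in> C}"
      if g: "g \<in> carrier G" for g
    proof clarify
      fix x assume x: "x \<in> topspace N" "e x \<in> C"
      have "?\<psi> g (e x) \<in> C" using C(3) g x(2) by blast
      then show "\<psi> g x \<in> topspace N \<and> e (\<psi> g x) \<in> C" using x g by (simp add: em de pm)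
    qed
    ultimately have "{x \<in> topspace N. e x \<in> C} = topspace N" using mn by blast
    then show ?thesis using Cs dm ed by (metis (mono_tags, lifting) mem_Collect_eq subsetI subset_antisym)
  qed
  have "compact_space N'" "Hausdorff_space N'"
    using cp H homeomorphic_compact_space[OF hs] homeomorphic_Hausdorff_space[OF hs] by auto
  moreover have "topspace N' \<noteq> {}" using ne em by blast
  ultimately show ?thesis
    using ga' jc' mn' unfolding minimal_flow_def flow_def by meson
qed

lemma universal_minimal_flowD:
  fixes M :: "'m topology" and N :: "'n topology" and G :: "'g monoid"
  assumes T: "topspace T = carrier G"
    and M: "universal_minimal_flow G T M \<phi>" and N: "minimal_flow G T N \<psi>"
  shows "\<exists>f. flow_map G M \<phi> N \<psi> f"
proof -
  obtain e :: "'n \<Rightarrow> 'g set set" where inj: "inj_on e (topspace N)"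
    using minimal_flow_embeds[OF T N] by blast
  define d where "d = inv_into (topspace N) e"
  define N' where "N' = pullback_topology (e ` topspace N) d N"
  have de: "\<And>x. x \<in> topspace N \<Longrightarrow> d (e x) = x" using inj by (simp add: d_def)
  have tN': "topspace N' = e ` topspace N"
    unfolding N'_def topspace_pullback_topology using de by auto
  have "continuous_map N' N d"
    unfolding N'_def by (rule continuous_map_pullback[of N N id, simplified])
  moreover have "continuous_map N N' e"
    unfolding N'_def
    by (rule continuous_map_pullback') (auto simp: o_def de intro: continuous_map_eq[OF continuous_map_id])
  ultimately have hm: "homeomorphic_maps N N' e d"
    by (auto simp: homeomorphic_maps_def tN' de)
  from minimal_flow_transport[OF N T hm] M
  obtain f where f: "flow_map G M \<phi> N' (\<lambda>g. \<lambda>y\<in>topspace N'. e (\<psi> g (d y))) f"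
    unfolding universal_minimal_flow_def by meson
  have ga: "group_action G (topspace N) \<psi>" using N by (simp add: minimal_flow_def flow_def)
  have "flow_map G M \<phi> N \<psi> (d \<circ> f)"
    unfolding flow_map_def
  proof (intro conjI ballI)
    have cf: "continuous_map M N' f" using f by (simp add: flow_map_def)
    show "continuous_map M N (d \<circ> f)"
      using continuous_map_compose[OF cf] hm unfolding homeomorphic_maps_def by blast
    fix g x assume g: "g \<in> carrier G" and x: "x \<in> topspace M"
    have fx: "f x \<in> topspace N'" using cf x by (auto simp: continuous_map_def)
    then have "d (f x) \<in> topspace N" by (auto simp: tN' de)
    then have "\<psi> g (d (f x)) \<in> topspace N" using group_action.element_image[OF ga g] by blast
    then show "(d \<circ> f) (\<phi> g x) = \<psi> g ((d \<circ> f) x)"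
      using f g x fx by (simp add: flow_map_def de)
  qed
  then show ?thesis by blast
qed

end

theory Submission
  imports Defs
begin

text \<open>
  Write \<open>G\<close> for the general linear group of the space.  The proof compares category and measure
  on one explicit factor of the universal minimal flow, the space of flag preorders.  A flag preorder
  is a total preorder on the vector space whose initial segments are subspaces and which induces a
  full flag on every finite dimensional subspace; it is what remains of a natural ordering when
  only the positions of the leading coordinates are remembered.  Any two full flags of a
  finite dimensional subspace are exchanged by an element of \<open>G\<close>, so every orbit of flag preorders
  is dense and the flow is minimal (\<open>flag_minimal_flow\<close>).  Hence there is an equivariant surjection
  \<open>f\<close> from the universal minimal flow \<open>M\<close> onto it.

  The event that separates category from measure is ``the preorder \<open>f p\<close> has a greatest class''.

  For category: this event is the union, over the countably many vectors \<open>x\<close>, of the closed sets on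
  which \<open>x\<close> is greatest, and it is \<open>G\<close>-invariant.  It is not all of \<open>M\<close>, because the filtration
  of the space by the spans of initial segments of a basis is a flag preorder without a greatest
  class.  In a minimal flow, an invariant set that is a countable union of closed sets and is not
  everything is meager, and so it is disjoint from the generic orbit
  (\<open>generic_orbit_disjoint_invariant_fsigma\<close>).

  For measure: let \<open>W\<close> be a nonzero finite dimensional subspace.  In every flag preorder the
  non-greatest vectors of \<open>W\<close> form a hyperplane, so at least half of the vectors of \<open>W\<close> are
  greatest in \<open>W\<close> (\<open>card_flag_max\<close>).  Since \<open>GL(W)\<close> is transitive on nonzero vectors, an invariant
  probability measure gives the event ``\<open>x\<close> is greatest in \<open>W\<close>'' the same probability for all nonzero
  \<open>x\<close> in \<open>W\<close>, and this probability is therefore at least one half.  Letting \<open>W\<close> grow to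
  the whole space, a fixed nonzero \<open>x\<close> is greatest with probability at least one half.  A set of
  positive measure thus misses the generic orbit.
\<close>

section \<open>Minimal flows and generic orbits\<close>

lemma flow_continuous_map:
  assumes "flow G T M \<phi>" and "topspace T = carrier G" and "g \<in> carrier G"
  shows "continuous_map M M (\<phi> g)"
proof -
  have "continuous_map M (prod_topology T M) (\<lambda>x. (g, x))"
    using assms by (simp add: continuous_map_pairwise o_def)
  moreover have "continuous_map (prod_topology T M) M (\<lambda>(g, x). \<phi> g x)"
    using assms by (simp add: flow_def)
  ultimately have "continuous_map M M ((\<lambda>(g, x). \<phi> g x) \<circ> (\<lambda>x. (g, x)))"
    by (rule continuous_map_compose)
  then show ?thesis by (simp add: o_def)
qed

text \<open>
  The points whose orbit avoids the interior of \<open>F\<close> form a closed invariant set, and it contains every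
  point outside \<open>Q\<close>.  Minimality makes it everything, so the interior is empty.
\<close>

lemma subset_of_invariant_empty_interior:
  assumes M: "minimal_flow G T M \<phi>" and T: "topspace T = carrier G"
    and Q: "F \<subseteq> Q" "Q \<subset> topspace M"
    and inv: "\<And>g p. g \<in> carrier G \<Longrightarrow> p \<in> Q \<Longrightarrow> \<phi> g p \<in> Q"
  shows "M interior_of F = {}"
proof -
  have fl: "flow G T M \<phi>"
    and mn: "\<And>C. closedin M C \<Longrightarrow> C \<noteq> {} \<Longrightarrow> (\<forall>g\<in>carrier G. \<phi> g ` C \<subseteq> C) \<Longrightarrow> C = topspace M"
    using M unfolding minimal_flow_def by blast+
  interpret A: group_action G "topspace M" \<phi> using fl by (simp add: flow_def)
  interpret group G using A.group_hom by (simp add: group_hom_def)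
  define U where "U = M interior_of F"
  define C where "C = {p \<in> topspace M. \<forall>g\<in>carrier G. \<phi> g p \<notin> U}"
  have "C = topspace M - (\<Union>g\<in>carrier G. {p \<in> topspace M. \<phi> g p \<in> U})"
    by (auto simp: C_def)
  moreover have op: "openin M {p \<in> topspace M. \<phi> g p \<in> U}" if "g \<in> carrier G" for g
    using openin_continuous_map_preimage[OF flow_continuous_map[OF fl T that]] U_def by simp
  have "openin M (\<Union>g\<in>carrier G. {p \<in> topspace M. \<phi> g p \<in> U})"
    by (rule openin_Union) (use op in blast)
  ultimately have cl: "closedin M C" by (simp add: closedin_diff)
  obtain p where p: "p \<in> topspace M" "p \<notin> Q" using Q by blast
  have "\<phi> g p \<notin> U" if g: "g \<in> carrier G" for g
  proof
    assume "\<phi> g p \<in> U"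
    then have "\<phi> g p \<in> Q" using interior_of_subset[of M F] Q(1) unfolding U_def by blast
    then have "\<phi> (inv\<^bsub>G\<^esub> g) (\<phi> g p) \<in> Q" using inv g by blast
    then show False using A.orbit_sym_aux[OF g p(1) refl] p(2) by simp
  qed
  then have "C \<noteq> {}" using p by (auto simp: C_def)
  moreover have "\<phi> g ` C \<subseteq> C" if g: "g \<in> carrier G" for g
  proof clarify
    fix p assume p: "p \<in> C"
    have "\<phi> h (\<phi> g p) \<notin> U" if h: "h \<in> carrier G" for h
    proof -
      have "\<phi> (h \<otimes>\<^bsub>G\<^esub> g) p \<notin> U" using p g h by (simp add: C_def)
      then show ?thesis using A.composition_rule[of p h g] p g h by (simp add: C_def)
    qed
    moreover have "\<phi> g p \<in> topspace M" using p A.element_image[OF g _ refl] by (simp add: C_def)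
    ultimately show "\<phi> g p \<in> C" by (simp add: C_def)
  qed
  ultimately have eq: "C = topspace M" using mn[OF cl] by simp
  have "p \<notin> U" for p
  proof
    assume p: "p \<in> U"
    then have "p \<in> topspace M" using interior_of_subset_topspace[of M F] unfolding U_def by blast
    then have "\<phi> \<one>\<^bsub>G\<^esub> p = p" "p \<in> C"
      using fun_cong[OF A.id_eq_one, of p] eq by auto
    then show False using p one_closed unfolding C_def by force
  qed
  then show ?thesis unfolding U_def by blast
qed

text \<open>
  If the generic orbit met the invariant set \<open>\<Union>\<F>\<close>, it would lie inside it.  The space
  would then be covered by \<open>\<F>\<close> together with the countably many nowhere dense sets that cover the
  complement of the orbit, against the Baire category theorem.
\<close>

lemma generic_orbit_disjoint_invariant_fsigma:
  assumes M: "minimal_flow G T M \<phi>" and T: "topspace T = carrier G"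
    and S: "generic_orbit G M \<phi> S"
    and F: "countable \<F>" "\<And>F. F \<in> \<F> \<Longrightarrow> closedin M F" "\<Union>\<F> \<noteq> topspace M"
    and inv: "\<And>g p. g \<in> carrier G \<Longrightarrow> p \<in> \<Union>\<F> \<Longrightarrow> \<phi> g p \<in> \<Union>\<F>"
  shows "S \<inter> \<Union>\<F> = {}"
proof (rule ccontr)
  assume "S \<inter> \<Union>\<F> \<noteq> {}"
  then obtain p where p: "p \<in> S" "p \<in> \<Union>\<F>" by blast
  have fl: "flow G T M \<phi>" and ne: "topspace M \<noteq> {}"
    using M unfolding minimal_flow_def by blast+
  interpret A: group_action G "topspace M" \<phi> using fl by (simp add: flow_def)
  interpret group G using A.group_hom by (simp add: group_hom_def)
  have sub: "\<Union>\<F> \<subset> topspace M" using F closedin_subset by blast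
  obtain q where q: "q \<in> topspace M" "S = orbit G \<phi> q"
    using S by (auto simp: generic_orbit_def orbits_def)
  obtain h where h: "h \<in> carrier G" "p = \<phi> h q" using p q by (auto simp: orbit_def)
  have "q \<in> \<Union>\<F>"
    using inv[of "inv\<^bsub>G\<^esub> h" p] h p A.orbit_sym_aux[OF h(1) q(1) refl] by simp
  then have SF: "S \<subseteq> \<Union>\<F>" using inv by (force simp: q orbit_def)
  obtain \<U> where U: "countable \<U>" "\<And>U. U \<in> \<U> \<Longrightarrow> openin M U"
    "\<And>U. U \<in> \<U> \<Longrightarrow> M closure_of U = topspace M" "topspace M \<inter> \<Inter>\<U> \<subseteq> S"
    using S by (auto simp: generic_orbit_def comeager_in_def)
  define \<G> where "\<G> = \<F> \<union> (\<lambda>U. topspace M - U) ` \<U>"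
  have "countable \<G>" using F U by (simp add: \<G>_def)
  moreover have "closedin M C \<and> M interior_of C = {}" if "C \<in> \<G>" for C
    using that unfolding \<G>_def
  proof
    assume "C \<in> \<F>"
    then show ?thesis using F subset_of_invariant_empty_interior[OF M T _ sub inv] by blast
  next
    assume "C \<in> (\<lambda>U. topspace M - U) ` \<U>"
    then show ?thesis using U by (auto simp: interior_of_complement)
  qed
  moreover have "locally_compact_space M \<and> regular_space M"
    using fl by (simp add: flow_def compact_imp_locally_compact_space
        compact_Hausdorff_imp_regular_space)
  ultimately have "M interior_of \<Union>\<G> = {}" by (intro Baire_category_alt) auto
  moreover have "\<Union>\<G> = topspace M"
  proof
    show "\<Union>\<G> \<subseteq> topspace M" using sub by (auto simp: \<G>_def)
    show "topspace M \<subseteq> \<Union>\<G>"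
    proof
      fix x assume x: "x \<in> topspace M"
      show "x \<in> \<Union>\<G>"
      proof (cases "x \<in> \<Inter>\<U>")
        case True
        then have "x \<in> \<Union>\<F>" using x U(4) SF by blast
        then show ?thesis by (auto simp: \<G>_def)
      qed (use x in \<open>auto simp: \<G>_def\<close>)
    qed
  qed
  ultimately have "M interior_of topspace M = {}" by (simp only:)
  then show False using ne by (simp only: interior_of_topspace)
qed

lemma flow_map_surj:
  assumes M: "minimal_flow G T M \<phi>" and N: "minimal_flow G T N \<psi>" and f: "flow_map G M \<phi> N \<psi> f"
  shows "f ` topspace M = topspace N"
proof -
  have cf: "continuous_map M N f" using f by (simp add: flow_map_def)
  have cM: "compact_space M" and ne: "topspace M \<noteq> {}" and ga: "group_action G (topspace M) \<phi>"
    using M by (auto simp: minimal_flow_def flow_def)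
  have H: "Hausdorff_space N"
    and mn: "\<And>C. closedin N C \<Longrightarrow> C \<noteq> {} \<Longrightarrow> (\<forall>g\<in>carrier G. \<psi> g ` C \<subseteq> C) \<Longrightarrow> C = topspace N"
    using N unfolding minimal_flow_def flow_def by blast+
  have "closedin N (f ` topspace M)"
    using cM cf H by (meson compact_space_def compactin_imp_closedin image_compactin)
  moreover have "\<psi> g ` f ` topspace M \<subseteq> f ` topspace M" if g: "g \<in> carrier G" for g
  proof clarify
    fix p assume p: "p \<in> topspace M"
    then have "\<psi> g (f p) = f (\<phi> g p)" using f g by (simp add: flow_map_def)
    then show "\<psi> g (f p) \<in> f ` topspace M"
      using group_action.element_image[OF ga g p refl] by simp
  qed
  ultimately show ?thesis using ne by (intro mn) auto
qed


section \<open>The Cantor cube\<close>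

abbreviation cantor_cube :: "('i \<Rightarrow> bool) topology"
  where "cantor_cube \<equiv> product_topology (\<lambda>_. discrete_topology UNIV) UNIV"

lemma openin_cantor_cube:
  "openin cantor_cube U \<longleftrightarrow>
    (\<forall>R\<in>U. \<exists>F. finite F \<and> (\<forall>R'. (\<forall>i\<in>F. R' i = R i) \<longrightarrow> R' \<in> U))"
proof
  assume U: "openin cantor_cube U"
  show "\<forall>R\<in>U. \<exists>F. finite F \<and> (\<forall>R'. (\<forall>i\<in>F. R' i = R i) \<longrightarrow> R' \<in> U)"
  proof
    fix R assume "R \<in> U"
    with U obtain B where B: "finite {i. B i \<noteq> UNIV}" "R \<in> Pi\<^sub>E UNIV B" "Pi\<^sub>E UNIV B \<subseteq> U"
      unfolding openin_product_topology_alt by force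
    have "R' \<in> U" if "\<forall>i\<in>{i. B i \<noteq> UNIV}. R' i = R i" for R'
    proof -
      have "R' i \<in> B i" for i
        using that B(2) by (cases "B i = UNIV") (auto simp: PiE_iff)
      then show ?thesis using B(3) by (auto simp: PiE_iff)
    qed
    then show "\<exists>F. finite F \<and> (\<forall>R'. (\<forall>i\<in>F. R' i = R i) \<longrightarrow> R' \<in> U)" using B(1) by blast
  qed
next
  assume *: "\<forall>R\<in>U. \<exists>F. finite F \<and> (\<forall>R'. (\<forall>i\<in>F. R' i = R i) \<longrightarrow> R' \<in> U)"
  show "openin cantor_cube U"
    unfolding openin_product_topology_alt
  proof
    fix R assume "R \<in> U"
    with * obtain F where F: "finite F" "\<And>R'. (\<forall>i\<in>F. R' i = R i) \<Longrightarrow> R' \<in> U" by blast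
    let ?B = "\<lambda>i. if i \<in> F then {R i} else UNIV"
    have "finite {i. ?B i \<noteq> UNIV}" by (rule finite_subset[OF _ F(1)]) auto
    moreover have "Pi\<^sub>E UNIV ?B \<subseteq> U"
    proof
      fix R' assume R': "R' \<in> Pi\<^sub>E UNIV ?B"
      have "R' i = R i" if "i \<in> F" for i using R' that by (auto dest: PiE_mem[of _ _ _ i])
      then show "R' \<in> U" using F(2) by blast
    qed
    ultimately show "\<exists>B. finite {i \<in> UNIV. B i \<noteq> topspace (discrete_topology UNIV)} \<and>
        (\<forall>i\<in>UNIV. openin (discrete_topology UNIV) (B i)) \<and> R \<in> Pi\<^sub>E UNIV B \<and> Pi\<^sub>E UNIV B \<subseteq> U"
      by (intro exI[of _ ?B]) auto
  qed
qed

lemma closedin_cantor_cube: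
  "closedin cantor_cube C \<longleftrightarrow>
    (\<forall>R. R \<notin> C \<longrightarrow> (\<exists>F. finite F \<and> (\<forall>R'. (\<forall>i\<in>F. R' i = R i) \<longrightarrow> R' \<notin> C)))"
proof -
  have "closedin cantor_cube C \<longleftrightarrow> openin cantor_cube (- C)"
    by (simp add: closedin_def Compl_eq_Diff_UNIV)
  then show ?thesis by (auto simp add: openin_cantor_cube)
qed


section \<open>Flag preorders\<close>

text \<open>
  Finiteness of the field serves twice: finite dimensional subspaces are finite sets, so they can be
  counted, and the existential quantifier in the last clause of the next definition is a finite
  disjunction, so that it defines a closed set.
\<close>

locale finite_field_vector_space = vector_space smul
  for smul :: "'k::{field, finite} \<Rightarrow> 'v::ab_group_add \<Rightarrow> 'v"
begin

text \<open>
  The pair \<open>(u, v)\<close> is related when \<open>u\<close> lies in the smallest member of the flag that contains \<open>v\<close>.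
  The last clause says that consecutive members of the flag differ by one dimension: a vector in the
  class of \<open>w\<close> can be moved strictly below \<open>w\<close> by subtracting a multiple of \<open>w\<close>.
\<close>

definition flag_preorder :: "('v \<times> 'v \<Rightarrow> bool) \<Rightarrow> bool"
  where "flag_preorder R \<longleftrightarrow>
    (\<forall>u v. R (u, v) \<or> R (v, u)) \<and>
    (\<forall>u v w. R (u, v) \<longrightarrow> R (v, w) \<longrightarrow> R (u, w)) \<and>
    (\<forall>u v w. R (u, w) \<longrightarrow> R (v, w) \<longrightarrow> R (u + v, w)) \<and>
    (\<forall>c u. R (smul c u, u)) \<and>
    (\<forall>u. R (u, 0) \<longrightarrow> u = 0) \<and>
    (\<forall>u w. w \<noteq> 0 \<longrightarrow> R (u, w) \<longrightarrow> (\<exists>c. \<not> R (w, u - smul c w)))"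

lemma flag_preorderD:
  assumes "flag_preorder R"
  shows flag_total: "R (u, v) \<or> R (v, u)"
    and flag_trans: "R (u, v) \<Longrightarrow> R (v, w) \<Longrightarrow> R (u, w)"
    and flag_add: "R (u, w) \<Longrightarrow> R (v, w) \<Longrightarrow> R (u + v, w)"
    and flag_smul: "R (smul c u, u)"
    and flag_zero: "R (u, 0) \<Longrightarrow> u = 0"
    and flag_reduce: "w \<noteq> 0 \<Longrightarrow> R (u, w) \<Longrightarrow> \<exists>c. \<not> R (w, u - smul c w)"
proof -
  note D = assms[unfolded flag_preorder_def]
  show "R (u, v) \<or> R (v, u)"
    using D[THEN conjunct1] by blast
  show "R (u, v) \<Longrightarrow> R (v, w) \<Longrightarrow> R (u, w)"
    using D[THEN conjunct2, THEN conjunct1] by blast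
  show "R (u, w) \<Longrightarrow> R (v, w) \<Longrightarrow> R (u + v, w)"
    using D[THEN conjunct2, THEN conjunct2, THEN conjunct1] by blast
  show "R (smul c u, u)"
    using D[THEN conjunct2, THEN conjunct2, THEN conjunct2, THEN conjunct1] by blast
  show "R (u, 0) \<Longrightarrow> u = 0"
    using D[THEN conjunct2, THEN conjunct2, THEN conjunct2, THEN conjunct2, THEN conjunct1] by blast
  show "w \<noteq> 0 \<Longrightarrow> R (u, w) \<Longrightarrow> \<exists>c. \<not> R (w, u - smul c w)"
    using D[THEN conjunct2, THEN conjunct2, THEN conjunct2, THEN conjunct2, THEN conjunct2] by blast
qed

lemma subspace_flag_below:
  assumes R: "flag_preorder R" and W: "subspace W" and x: "x \<noteq> 0"
  shows "subspace {v \<in> W. \<not> R (x, v)}"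
proof (rule subspaceI)
  show "0 \<in> {v \<in> W. \<not> R (x, v)}" using flag_zero[OF R] W x subspace_0 by blast
next
  fix u v assume uv: "u \<in> {v \<in> W. \<not> R (x, v)}" "v \<in> {v \<in> W. \<not> R (x, v)}"
  have "\<not> R (x, u + v)"
  proof (cases "R (u, v)")
    case True
    then have "R (u + v, v)" using flag_add[OF R] flag_total[OF R, of v v] by blast
    then show ?thesis using uv flag_trans[OF R] by blast
  next
    case False
    then have "R (u + v, u)"
      using flag_add[OF R] flag_total[OF R, of u u] flag_total[OF R, of u v] by blast
    then show ?thesis using uv flag_trans[OF R] by blast
  qed
  then show "u + v \<in> {v \<in> W. \<not> R (x, v)}" using uv W subspace_add by blast
next
  fix c v assume "v \<in> {v \<in> W. \<not> R (x, v)}"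
  then show "smul c v \<in> {v \<in> W. \<not> R (x, v)}"
    using W subspace_scale flag_smul[OF R, of c v] flag_trans[OF R] by blast
qed

lemma flag_has_max:
  assumes R: "flag_preorder R" and "finite W" and "W \<noteq> {}"
  shows "\<exists>x\<in>W. \<forall>v\<in>W. R (v, x)"
  using assms(2,3)
proof (induction W rule: finite_ne_induct)
  case (singleton x)
  then show ?case using flag_total[OF R] by blast
next
  case (insert y W)
  then obtain x where x: "x \<in> W" "\<forall>v\<in>W. R (v, x)" by blast
  show ?case
  proof (cases "R (y, x)")
    case True
    then show ?thesis using x by blast
  next
    case False
    then have "R (x, y)" using flag_total[OF R] by blast
    then have "\<forall>v\<in>insert y W. R (v, y)"
      using x flag_trans[OF R] flag_total[OF R, of y y] by blast
    then show ?thesis by blast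
  qed
qed

text \<open>
  The basis is built from the bottom: the non-greatest vectors of \<open>W\<close> form a hyperplane \<open>H\<close>, and a
  greatest vector extends an adapted basis of \<open>H\<close> to one of \<open>W\<close>.  The point of the conclusion is that
  \<open>R\<close> on \<open>W\<close> can be read off from the spans of the initial segments of \<open>w\<close>, so a linear map that
  carries one adapted basis to another carries one preorder to the other.
\<close>

lemma flag_adapted_basis:
  assumes R: "flag_preorder R" and "finite W" and "subspace W"
  shows "\<exists>w n. inj_on w {..<n} \<and> independent (w ` {..<n}) \<and> span (w ` {..<n}) = W \<and>
    (\<forall>u\<in>W. \<forall>v\<in>W. R (u, v) \<longleftrightarrow> (\<forall>k\<le>n::nat. v \<in> span (w ` {..<k}) \<longrightarrow> u \<in> span (w ` {..<k})))"
  using assms(2,3)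
proof (induction W rule: finite_psubset_induct)
  case (psubset W)
  show ?case
  proof (cases "W = {0}")
    case True
    show ?thesis
      using flag_total[OF R, of 0 0]
      by (intro exI[of _ "\<lambda>_. 0"] exI[of _ 0]) (simp add: True dependent_def)
  next
    case False
    then have "W \<noteq> {}" "\<exists>y\<in>W. y \<noteq> 0" using psubset.prems subspace_0 by auto
    then obtain y x where y: "y \<in> W" "y \<noteq> 0" and x: "x \<in> W" "\<And>v. v \<in> W \<Longrightarrow> R (v, x)"
      using flag_has_max[OF R psubset.hyps(1)] by blast
    have x0: "x \<noteq> 0" using x(2)[OF y(1)] y(2) flag_zero[OF R] by blast
    define H where "H = {v \<in> W. \<not> R (x, v)}"
    have xH: "x \<notin> H" and HW: "H \<subset> W" using x by (auto simp: H_def)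
    have sH: "subspace H" unfolding H_def using subspace_flag_below[OF R psubset.prems x0] .
    obtain w and m :: nat where wm: "inj_on w {..<m}" "independent (w ` {..<m})" "span (w ` {..<m}) = H"
      and Rw: "\<forall>u\<in>H. \<forall>v\<in>H.
        R (u, v) \<longleftrightarrow> (\<forall>k\<le>m. v \<in> span (w ` {..<k}) \<longrightarrow> u \<in> span (w ` {..<k}))"
      using psubset.IH[OF HW sH] by blast
    \<comment> \<open>The greatest vector gets the last index, so the initial segments of \<open>w\<close> are unchanged.\<close>
    define w' where "w' = w(m := x)"
    have im: "w' ` {..<k} = w ` {..<k}" if "k \<le> m" for k
      using that by (auto simp: w'_def)
    have im': "w' ` {..<Suc m} = insert x (w ` {..<m})"
      using im[of m] by (simp add: lessThan_Suc) (simp add: w'_def)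
    have inj: "inj_on w' {..<Suc m}"
    proof -
      have "inj_on w' {..<m}" using wm(1) by (simp add: w'_def inj_on_def)
      moreover have "w' m \<notin> w' ` {..<m}"
        using xH wm(3) span_superset[of "w ` {..<m}"] im[of m] by (auto simp: w'_def)
      ultimately show ?thesis by (simp add: lessThan_Suc)
    qed
    have ind: "independent (w' ` {..<Suc m})"
      unfolding im' using independent_insertI wm xH by blast
    have sp: "span (w' ` {..<Suc m}) = W"
    proof
      show "span (w' ` {..<Suc m}) \<subseteq> W"
        unfolding im' using x(1) wm(3) HW span_superset[of "w ` {..<m}"] psubset.prems
        by (intro span_minimal) auto
      show "W \<subseteq> span (w' ` {..<Suc m})"
      proof
        fix v assume v: "v \<in> W"
        obtain c where "\<not> R (x, v - smul c x)" using flag_reduce[OF R x0 x(2)[OF v]] by blast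
        then have "v - smul c x \<in> H"
          using v x(1) psubset.prems by (simp add: H_def subspace_diff subspace_scale)
        then show "v \<in> span (w' ` {..<Suc m})" unfolding im' span_insert wm(3) by blast
      qed
    qed
    have "R (u, v) \<longleftrightarrow> (\<forall>k\<le>Suc m. v \<in> span (w' ` {..<k}) \<longrightarrow> u \<in> span (w' ` {..<k}))"
      if u: "u \<in> W" and v: "v \<in> W" for u v
    proof -
      have split: "(\<forall>k\<le>Suc m. v \<in> span (w' ` {..<k}) \<longrightarrow> u \<in> span (w' ` {..<k})) \<longleftrightarrow>
          (\<forall>k\<le>m. v \<in> span (w ` {..<k}) \<longrightarrow> u \<in> span (w ` {..<k}))"
        using u sp im by (auto simp: le_Suc_eq)
      show ?thesis unfolding split
      proof (cases "v \<in> H")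
        case False
        have "R (u, v)"
          using False v x(2)[OF u] flag_trans[OF R] by (auto simp: H_def)
        moreover have "v \<notin> span (w ` {..<k})" if "k \<le> m" for k
        proof -
          have "span (w ` {..<k}) \<subseteq> H" unfolding wm(3)[symmetric] using that by (intro span_mono) auto
          then show ?thesis using False by blast
        qed
        ultimately show "R (u, v) \<longleftrightarrow> (\<forall>k\<le>m. v \<in> span (w ` {..<k}) \<longrightarrow> u \<in> span (w ` {..<k}))"
          by blast
      next
        case vH: True
        show "R (u, v) \<longleftrightarrow> (\<forall>k\<le>m. v \<in> span (w ` {..<k}) \<longrightarrow> u \<in> span (w ` {..<k}))"
        proof (cases "u \<in> H")
          case True
          then show ?thesis using Rw vH by blast
        next
          case False
          have "\<not> R (u, v)" using False u vH flag_trans[OF R] by (auto simp: H_def)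
          then show ?thesis using False vH wm(3) by blast
        qed
      qed
    qed
    then show ?thesis using inj ind sp by (intro exI[of _ w'] exI[of _ "Suc m"]) blast
  qed
qed


section \<open>The general linear group\<close>

text \<open>
  A map between two bases of the same subspace \<open>span A\<close> is extended by the identity on the complement
  \<open>span C\<close> given by a completion of \<open>A\<close> to a basis.  With \<open>p\<close> the projection onto \<open>span A\<close> along
  that complement, the extension of \<open>k\<close> is \<open>v \<mapsto> k (p v) + (v - p v)\<close>; this form shows at once that
  the extensions of mutually inverse maps are mutually inverse, in infinite dimension as well.
\<close>

lemma independent_bij_extends_to_automorphism:
  assumes A: "independent A" and A': "independent A'" and sp: "span A = span A'"
    and h: "bij_betw h A A'"
  shows "\<exists>g\<in>carrier (GL_group smul). \<forall>a\<in>A. g a = h a"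
proof -
  interpret vector_space_pair smul smul by unfold_locales
  define C where "C = extend_basis A - A"
  have AC: "A \<union> C = extend_basis A" "A \<inter> C = {}"
    using extend_basis_superset[OF A] by (auto simp: C_def)
  obtain p where p: "Vector_Spaces.linear smul smul p"
      "\<And>v. v \<in> extend_basis A \<Longrightarrow> p v = (if v \<in> A then v else 0)"
    using linear_independent_extend[OF independent_extend_basis[OF A],
        of "\<lambda>v. if v \<in> A then v else 0"] by metis
  obtain h1 where h1: "Vector_Spaces.linear smul smul h1" "\<And>a. a \<in> A \<Longrightarrow> h1 a = h a"
    using linear_independent_extend[OF A] by metis
  obtain h2 where h2: "Vector_Spaces.linear smul smul h2" "\<And>a. a \<in> A' \<Longrightarrow> h2 a = inv_into A h a"
    using linear_independent_extend[OF A'] by metis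
  have "p a = id a" if "a \<in> A" for a using p(2)[of a] AC that by auto
  then have p1: "p v = v" if "v \<in> span A" for v
    using linear_eq_on[OF p(1) linear_id that] by simp
  have pA: "p v \<in> span A" for v
  proof -
    have "p ` extend_basis A \<subseteq> span A" using p(2) span_base span_zero by auto
    then have "span (p ` extend_basis A) \<subseteq> span A" by (simp add: span_minimal)
    then show ?thesis using linear_span_image[OF p(1), of "extend_basis A"] A by auto
  qed
  have im1: "h1 v \<in> span A" if "v \<in> span A" for v
  proof -
    have "h1 ` A \<subseteq> span A" using h1 h sp span_base by (auto simp: bij_betw_def)
    then show ?thesis using that linear_span_image[OF h1(1), of A] span_minimal[of "h1 ` A" "span A"]
      by auto
  qed
  have im2: "h2 v \<in> span A" if "v \<in> span A" for v
  proof -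
    have "h2 ` A' \<subseteq> span A" using h2 h span_base by (auto simp: bij_betw_def inv_into_into)
    then show ?thesis
      using that linear_span_image[OF h2(1), of A'] span_minimal[of "h2 ` A'" "span A"] sp by auto
  qed
  have i21: "h2 (h1 v) = v" if "v \<in> span A" for v
    using linear_eq_on[OF Vector_Spaces.linear_compose[OF h1(1) h2(1)] linear_id that] h1 h2 h
    by (auto simp: bij_betw_def)
  have i12: "h1 (h2 v) = v" if "v \<in> span A" for v
    using linear_eq_on[OF Vector_Spaces.linear_compose[OF h2(1) h1(1)] linear_id, of v A'] that h1 h2 h sp
    by (auto simp: bij_betw_def f_inv_into_f inv_into_into)
  define ext where "ext k v = k (p v) + (v - p v)" for k :: "'v \<Rightarrow> 'v" and v
  have pext: "p (ext k v) = k (p v)" if "\<And>v. v \<in> span A \<Longrightarrow> k v \<in> span A" for k v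
    using that[OF pA[of v]] pA[of v] p1 by (simp add: ext_def linear_add[OF p(1)] linear_diff[OF p(1)])
  have "ext h2 (ext h1 v) = v" "ext h1 (ext h2 v) = v" for v
    unfolding ext_def[of _ "ext _ _"] using pext im1 im2 i12 i21 pA by (auto simp: ext_def)
  then have "bij (ext h1)" by (intro o_bij[of "ext h2"]) auto
  moreover have "Vector_Spaces.linear smul smul (ext h1)"
    unfolding ext_def
    using linear_compose_add[OF Vector_Spaces.linear_compose[OF p(1) h1(1)]
        linear_compose_sub[OF linear_id p(1)]] by (simp add: o_def id_def)
  moreover have "ext h1 a = h a" if "a \<in> A" for a
    using that p1[OF span_base[OF that]] h1 by (simp add: ext_def)
  ultimately show ?thesis by (auto simp: GL_group_def)
qed

lemma GL_groupD:
  assumes "g \<in> carrier (GL_group smul)"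
  shows "Vector_Spaces.linear smul smul g" "bij g"
  using assms by (auto simp: GL_group_def)

lemma group_GL_group: "group (GL_group smul)"
proof (rule groupI)
  fix g assume g: "g \<in> carrier (GL_group smul)"
  interpret vector_space_pair smul smul by unfold_locales
  have "inj g" "surj g" using g by (auto simp: GL_group_def bij_def)
  then obtain h where h: "Vector_Spaces.linear smul smul h" "h \<circ> g = id"
    using linear_injective_left_inverse GL_groupD(1)[OF g] by blast
  have "g \<circ> h = id"
    using h(2) \<open>surj g\<close> by (metis comp_assoc comp_id fun.map_id surj_iff)
  then have "bij h" using h(2) by (intro o_bij[of g])
  then show "\<exists>h\<in>carrier (GL_group smul). h \<otimes>\<^bsub>GL_group smul\<^esub> g = \<one>\<^bsub>GL_group smul\<^esub>"
    using h by (auto simp: GL_group_def)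
next
  fix g h assume "g \<in> carrier (GL_group smul)" "h \<in> carrier (GL_group smul)"
  then show "g \<otimes>\<^bsub>GL_group smul\<^esub> h \<in> carrier (GL_group smul)"
    by (auto simp: GL_group_def intro!: bij_comp Vector_Spaces.linear_compose)
qed (simp_all add: GL_group_def linear_id comp_assoc)

text \<open>The inverse of \<open>g\<close> as a function; the symbol \<open>inv\<close> is taken by the inverse in a group structure.\<close>

abbreviation inv_fun :: "('v \<Rightarrow> 'v) \<Rightarrow> 'v \<Rightarrow> 'v"
  where "inv_fun g \<equiv> inv_into UNIV g"

lemma GL_inverse:
  assumes g: "g \<in> carrier (GL_group smul)"
  shows "inv_fun g \<in> carrier (GL_group smul)"
proof -
  interpret GL: group "GL_group smul" by (rule group_GL_group)
  obtain h where h: "h \<in> carrier (GL_group smul)" "h \<circ> g = id"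
    using GL.inv_closed[OF g] GL.l_inv[OF g] by (auto simp: GL_group_def)
  have "inv_fun g = h"
    using h(2) GL_groupD(2)[OF g] by (metis bij_is_surj surj_iff comp_assoc comp_id id_comp)
  then show ?thesis using h by simp
qed


section \<open>The flow of flag preorders\<close>

definition flag_space :: "('v \<times> 'v \<Rightarrow> bool) topology"
  where "flag_space = subtopology cantor_cube {R. flag_preorder R}"

definition flag_action :: "('v \<Rightarrow> 'v) \<Rightarrow> ('v \<times> 'v \<Rightarrow> bool) \<Rightarrow> ('v \<times> 'v \<Rightarrow> bool)"
  where "flag_action g = (\<lambda>R\<in>Collect flag_preorder. \<lambda>(u, v). R (inv_fun g u, inv_fun g v))"

lemma topspace_flag_space: "topspace flag_space = Collect flag_preorder"
  by (simp add: flag_space_def)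

lemma flag_action_apply:
  "flag_preorder R \<Longrightarrow> flag_action g R (u, v) = R (inv_fun g u, inv_fun g v)"
  by (simp add: flag_action_def)

text \<open>
  Each instance of a clause of the definition involves only finitely many values of \<open>R\<close>, hence
  passes to the limit.  For the last clause the relevant values are those at \<open>(w, u - smul c w)\<close> for
  the finitely many scalars \<open>c\<close>.
\<close>

lemma closedin_flag_preorders: "closedin cantor_cube (Collect flag_preorder)"
proof -
  have lim: "flag_preorder R"
    if approx: "\<And>F. finite F \<Longrightarrow> \<exists>R'. (\<forall>i\<in>F. R' i = R i) \<and> flag_preorder R'" for R
    unfolding flag_preorder_def
  proof (intro conjI allI impI)
    fix u v
    show "R (u, v) \<or> R (v, u)"
      using approx[of "{(u, v), (v, u)}"] flag_total[of _ u v] by auto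
  next
    fix u v w assume "R (u, v)" "R (v, w)"
    then show "R (u, w)"
      using approx[of "{(u, v), (v, w), (u, w)}"] flag_trans[of _ u v w] by auto
  next
    fix u v w assume "R (u, w)" "R (v, w)"
    then show "R (u + v, w)"
      using approx[of "{(u, w), (v, w), (u + v, w)}"] flag_add[of _ u w v] by auto
  next
    fix c u
    show "R (smul c u, u)"
      using approx[of "{(smul c u, u)}"] flag_smul[of _ c u] by auto
  next
    fix u assume "R (u, 0)"
    then show "u = 0"
      using approx[of "{(u, 0)}"] flag_zero[of _ u] by auto
  next
    fix u w assume uw: "w \<noteq> 0" "R (u, w)"
    let ?F = "insert (u, w) (range (\<lambda>c. (w, u - smul c w)))"
    have "finite ?F" by simp
    from approx[OF this] obtain R' where R': "\<forall>i\<in>?F. R' i = R i" "flag_preorder R'" by blast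
    then obtain c where "\<not> R' (w, u - smul c w)" using flag_reduce[OF R'(2) uw(1), of u] uw(2) by auto
    then show "\<exists>c. \<not> R (w, u - smul c w)" using R'(1) by auto
  qed
  show ?thesis
    unfolding closedin_cantor_cube
  proof (intro allI impI, rule ccontr)
    fix R
    assume R: "R \<notin> Collect flag_preorder"
      and no: "\<nexists>F. finite F \<and> (\<forall>R'. (\<forall>i\<in>F. R' i = R i) \<longrightarrow> R' \<notin> Collect flag_preorder)"
    have "flag_preorder R"
    proof (rule lim)
      fix F :: "('v \<times> 'v) set" assume "finite F"
      then show "\<exists>R'. (\<forall>i\<in>F. R' i = R i) \<and> flag_preorder R'" using no by auto
    qed
    then show False using R by simp
  qed
qed

lemma flag_preorder_flag_action:
  assumes g: "g \<in> carrier (GL_group smul)" and R: "flag_preorder R"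
  shows "flag_preorder (flag_action g R)"
proof -
  interpret vector_space_pair smul smul by unfold_locales
  have bg: "bij g" using GL_groupD(2)[OF g] .
  have lin: "Vector_Spaces.linear smul smul (inv_fun g)" using GL_groupD(1)[OF GL_inverse[OF g]] .
  have inj: "inv_fun g u = 0 \<Longrightarrow> u = 0" for u
    using bg by (metis bij_is_surj linear_0[OF GL_groupD(1)[OF g]] surj_f_inv_f)
  show ?thesis
    unfolding flag_preorder_def flag_action_apply[OF R]
      linear_add[OF lin] linear_diff[OF lin] linear_scale[OF lin] linear_0[OF lin]
  proof (intro conjI allI impI)
    show "R (inv_fun g u, inv_fun g v) \<or> R (inv_fun g v, inv_fun g u)" for u v by (rule flag_total[OF R])
    show "R (inv_fun g u, inv_fun g v) \<Longrightarrow> R (inv_fun g v, inv_fun g w) \<Longrightarrow> R (inv_fun g u, inv_fun g w)" for u v w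
      by (rule flag_trans[OF R])
    show "R (inv_fun g u, inv_fun g w) \<Longrightarrow> R (inv_fun g v, inv_fun g w) \<Longrightarrow> R (inv_fun g u + inv_fun g v, inv_fun g w)" for u v w
      by (rule flag_add[OF R])
    show "R (smul c (inv_fun g u), inv_fun g u)" for c u by (rule flag_smul[OF R])
    show "R (inv_fun g u, 0) \<Longrightarrow> u = 0" for u using flag_zero[OF R] inj by blast
    show "w \<noteq> 0 \<Longrightarrow> R (inv_fun g u, inv_fun g w) \<Longrightarrow> \<exists>c. \<not> R (inv_fun g w, inv_fun g u - smul c (inv_fun g w))"
      for u w using flag_reduce[OF R] inj by blast
  qed
qed

lemma flag_group_action: "group_action (GL_group smul) (topspace flag_space) flag_action"
proof -
  have bij: "bij_betw (flag_action g) (Collect flag_preorder) (Collect flag_preorder)"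
    if g: "g \<in> carrier (GL_group smul)" for g
  proof (rule bij_betw_byWitness[where f' = "flag_action (inv_fun g)"])
    have bg: "bij g" using GL_groupD(2)[OF g] .
    show "\<forall>R\<in>Collect flag_preorder. flag_action (inv_fun g) (flag_action g R) = R"
      using bg flag_preorder_flag_action[OF g]
      by (auto simp: fun_eq_iff flag_action_apply inv_inv_eq bij_is_inj)
    show "\<forall>R\<in>Collect flag_preorder. flag_action g (flag_action (inv_fun g) R) = R"
      using bg flag_preorder_flag_action[OF GL_inverse[OF g]]
      by (auto simp: fun_eq_iff flag_action_apply inv_inv_eq bij_is_surj surj_f_inv_f)
  qed (use flag_preorder_flag_action g GL_inverse in auto)
  have "flag_action (g \<circ> h) = compose (Collect flag_preorder) (flag_action g) (flag_action h)"
    if g: "g \<in> carrier (GL_group smul)" and h: "h \<in> carrier (GL_group smul)" for g h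
  proof
    fix R
    show "flag_action (g \<circ> h) R = compose (Collect flag_preorder) (flag_action g) (flag_action h) R"
    proof (cases "flag_preorder R")
      case True
      then show ?thesis
        using flag_preorder_flag_action[OF h]
        by (auto simp: compose_def fun_eq_iff flag_action_apply
            o_inv_distrib[OF GL_groupD(2)[OF g] GL_groupD(2)[OF h]])
    qed (simp add: compose_def flag_action_def)
  qed
  then show ?thesis
    unfolding group_action_def group_hom_def group_hom_axioms_def topspace_flag_space
    using group_GL_group group_BijGroup bij
    by (auto simp: hom_def BijGroup_def Bij_def flag_action_def GL_group_def)
qed

lemma openin_GL_topology_point:
  "openin (GL_topology smul) {g \<in> carrier (GL_group smul). g a = u}"
proof -
  have "continuous_map (GL_topology smul) (discrete_topology UNIV) (\<lambda>g. g a)"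
    unfolding GL_topology_def
    by (intro continuous_map_from_subtopology continuous_map_product_projection) simp
  from openin_continuous_map_preimage[OF this, of "{u}"] show ?thesis
    by (simp add: topspace_GL_topology)
qed

lemma openin_flag_space_point: "openin flag_space {R. flag_preorder R \<and> R p = t}"
proof -
  have "continuous_map flag_space (discrete_topology UNIV) (\<lambda>R. R p)"
    unfolding flag_space_def
    by (intro continuous_map_from_subtopology continuous_map_product_projection) simp
  from openin_continuous_map_preimage[OF this, of "{t}"] show ?thesis
    by (simp add: topspace_flag_space)
qed

text \<open>
  Joint continuity holds because the value of \<open>flag_action g R\<close> at \<open>(u, v)\<close> depends only on the
  preimages of \<open>u\<close> and \<open>v\<close> under \<open>g\<close>, which are locally constant in \<open>g\<close>, and on one value of \<open>R\<close>.
\<close>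

lemma flag_flow: "flow (GL_group smul) (GL_topology smul) flag_space flag_action"
proof -
  have "compact_space flag_space"
    unfolding flag_space_def
    by (rule compact_space_subtopology[OF closedin_compact_space[OF _ closedin_flag_preorders]])
      (simp add: compact_space_product_topology compact_space_discrete_topology)
  moreover have "Hausdorff_space flag_space"
    unfolding flag_space_def
    by (intro Hausdorff_space_subtopology)
      (simp add: Hausdorff_space_product_topology Hausdorff_space_discrete_topology)
  moreover have "continuous_map (prod_topology (GL_topology smul) flag_space) flag_space
      (\<lambda>(g, R). flag_action g R)" (is "continuous_map ?P _ ?a")
  proof -
    have "continuous_map ?P cantor_cube ?a"
      unfolding continuous_map_componentwise_UNIV
    proof
      fix p :: "'v \<times> 'v"
      obtain u v where p: "p = (u, v)" by fastforce
      have "openin ?P {z \<in> topspace ?P. ?a z p \<in> U}" for U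
      proof (subst openin_subopen, rule ballI)
        fix z assume z: "z \<in> {z \<in> topspace ?P. ?a z p \<in> U}"
        obtain g R where gR: "z = (g, R)" by fastforce
        have g: "g \<in> carrier (GL_group smul)" and R: "flag_preorder R"
          using z by (auto simp: gR topspace_GL_topology topspace_flag_space)
        define A where "A = {g' \<in> carrier (GL_group smul). g' (inv_fun g u) = u} \<inter>
          {g' \<in> carrier (GL_group smul). g' (inv_fun g v) = v}"
        define B where "B = {R'. flag_preorder R' \<and> R' (inv_fun g u, inv_fun g v) = R (inv_fun g u, inv_fun g v)}"
        have "openin ?P (A \<times> B)"
          unfolding A_def B_def openin_prod_Times_iff
          using openin_GL_topology_point openin_flag_space_point by blast
        moreover have "z \<in> A \<times> B"
          using g R GL_groupD(2)[OF g] by (simp add: gR A_def B_def bij_is_surj surj_f_inv_f)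
        moreover have "A \<times> B \<subseteq> {z \<in> topspace ?P. ?a z p \<in> U}"
        proof
          fix z' assume "z' \<in> A \<times> B"
          then obtain g' R' where z': "z' = (g', R')" "g' \<in> A" "R' \<in> B" by blast
          then have g': "g' \<in> carrier (GL_group smul)" "g' (inv_fun g u) = u" "g' (inv_fun g v) = v"
            and R': "flag_preorder R'" "R' (inv_fun g u, inv_fun g v) = R (inv_fun g u, inv_fun g v)"
            by (auto simp: A_def B_def)
          have "inv_fun g' u = inv_fun g u" "inv_fun g' v = inv_fun g v"
            using g' GL_groupD(2)[OF g'(1)] by (metis bij_is_inj inv_f_f)+
          then have "?a (g', R') p = ?a z p"
            using R R' by (simp add: gR p flag_action_apply)
          then show "z' \<in> {z \<in> topspace ?P. ?a z p \<in> U}"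
            using z z'(1) g'(1) R'(1) by (simp add: topspace_GL_topology topspace_flag_space)
        qed
        ultimately show "\<exists>T. openin ?P T \<and> z \<in> T \<and> T \<subseteq> {z \<in> topspace ?P. ?a z p \<in> U}" by blast
      qed
      then show "continuous_map ?P (discrete_topology UNIV) (\<lambda>z. ?a z p)"
        by (simp add: continuous_map_def)
    qed
    moreover have "?a \<in> topspace ?P \<rightarrow> Collect flag_preorder"
      using flag_preorder_flag_action by (auto simp: topspace_GL_topology topspace_flag_space)
    ultimately show ?thesis
      unfolding flag_space_def by (simp add: continuous_map_in_subtopology)
  qed
  ultimately show ?thesis using flag_group_action by (simp add: flow_def)
qed

lemma finite_span:
  assumes "finite A"
  shows "finite (span A)"
  using assms
proof (induction A)
  case (insert a A)
  have "span (insert a A) \<subseteq> (\<Union>k. (\<lambda>y. y + smul k a) ` span A)"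
  proof
    fix x assume "x \<in> span (insert a A)"
    then obtain k where "x - smul k a \<in> span A" by (auto simp: span_insert)
    then have "x \<in> (\<lambda>y. y + smul k a) ` span A" by (rule rev_image_eqI) simp
    then show "x \<in> (\<Union>k. (\<lambda>y. y + smul k a) ` span A)" by blast
  qed
  moreover have "finite (\<Union>k. (\<lambda>y. y + smul k a) ` span A)" using insert.IH by simp
  ultimately show ?case by (rule finite_subset)
qed simp

text \<open>
  Finitely many values of a preorder only concern a finite subspace \<open>W\<close>.  There both preorders are
  determined by adapted bases, and some automorphism takes one adapted basis to the other.
\<close>

lemma flag_orbits_dense:
  assumes R: "flag_preorder R" and R': "flag_preorder R'" and F: "finite F"
  shows "\<exists>g\<in>carrier (GL_group smul). \<forall>p\<in>F. flag_action g R' p = R p"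
proof -
  define W where "W = span (fst ` F \<union> snd ` F)"
  have W: "finite W" "subspace W"
    using F by (simp_all add: W_def finite_span)
  have FW: "u \<in> W \<and> v \<in> W" if "(u, v) \<in> F" for u v
    using that unfolding W_def by (force intro: span_base)
  obtain w and n :: nat where w: "inj_on w {..<n}" "independent (w ` {..<n})" "span (w ` {..<n}) = W"
    and Rw: "\<And>u v. u \<in> W \<Longrightarrow> v \<in> W \<Longrightarrow>
      R (u, v) \<longleftrightarrow> (\<forall>k\<le>n. v \<in> span (w ` {..<k}) \<longrightarrow> u \<in> span (w ` {..<k}))"
    using flag_adapted_basis[OF R W] by metis
  obtain w' and n' :: nat where w': "inj_on w' {..<n'}" "independent (w' ` {..<n'})" "span (w' ` {..<n'}) = W"
    and Rw': "\<And>u v. u \<in> W \<Longrightarrow> v \<in> W \<Longrightarrow>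
      R' (u, v) \<longleftrightarrow> (\<forall>k\<le>n'. v \<in> span (w' ` {..<k}) \<longrightarrow> u \<in> span (w' ` {..<k}))"
    using flag_adapted_basis[OF R' W] by metis
  have n': "n' = n"
    using dim_span_eq_card_independent[OF w(2)] dim_span_eq_card_independent[OF w'(2)] w w'
    by (simp add: card_image)
  have "bij_betw (w \<circ> inv_into {..<n} w') (w' ` {..<n}) (w ` {..<n})"
    using w w' n' by (meson bij_betw_imageI bij_betw_inv_into bij_betw_trans)
  then obtain g where g: "g \<in> carrier (GL_group smul)"
      and "\<forall>a\<in>w' ` {..<n}. g a = (w \<circ> inv_into {..<n} w') a"
    using independent_bij_extends_to_automorphism[of "w' ` {..<n}" "w ` {..<n}"] w w' n' by metis
  then have gw: "g (w' i) = w i" if "i < n" for i using that w'(1) n' by simp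
  have bg: "bij g" using GL_groupD(2)[OF g] .
  interpret vector_space_pair smul smul by unfold_locales
  have span_g: "g ` span (w' ` {..<k}) = span (w ` {..<k})" if "k \<le> n" for k
  proof -
    have "g ` w' ` {..<k} = w ` {..<k}" using gw that by (force simp: image_image)
    then show ?thesis using linear_span_image[OF GL_groupD(1)[OF g], of "w' ` {..<k}"] by simp
  qed
  have mem: "inv_fun g v \<in> span (w' ` {..<k}) \<longleftrightarrow> v \<in> span (w ` {..<k})" if "k \<le> n" for k v
    using span_g[OF that] bg by (metis bij_inv_eq_iff image_iff)
  have "flag_action g R' (u, v) = R (u, v)" if "(u, v) \<in> F" for u v
  proof -
    have uv: "u \<in> W" "v \<in> W" using FW[OF that] by auto
    have "inv_fun g u \<in> W" "inv_fun g v \<in> W" using uv mem[of n] w w' n' by auto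
    then have "R' (inv_fun g u, inv_fun g v) = R (u, v)"
      using mem Rw[OF uv] Rw' n' by simp
    then show ?thesis by (simp add: flag_action_apply[OF R'])
  qed
  then show ?thesis using g by (intro bexI[of _ g]) auto
qed

lemma flag_minimal_flow:
  assumes "\<exists>R. flag_preorder R"
  shows "minimal_flow (GL_group smul) (GL_topology smul) flag_space flag_action"
  unfolding minimal_flow_def
proof (intro conjI allI impI)
  show "flow (GL_group smul) (GL_topology smul) flag_space flag_action" by (rule flag_flow)
  show "topspace flag_space \<noteq> {}" using assms by (simp add: topspace_flag_space)
next
  fix C assume C: "closedin flag_space C \<and> C \<noteq> {} \<and>
    (\<forall>g\<in>carrier (GL_group smul). flag_action g ` C \<subseteq> C)"
  then have sub: "C \<subseteq> Collect flag_preorder"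
    using closedin_subset topspace_flag_space by blast
  have cl: "closedin cantor_cube C"
    using C closedin_flag_preorders closedin_trans_full unfolding flag_space_def by blast
  obtain R' where R': "R' \<in> C" using C by blast
  have "R \<in> C" if R: "flag_preorder R" for R
  proof (rule ccontr)
    assume "R \<notin> C"
    then obtain F where F: "finite F" "\<And>R'. (\<forall>i\<in>F. R' i = R i) \<Longrightarrow> R' \<notin> C"
      using cl unfolding closedin_cantor_cube by blast
    obtain g where "g \<in> carrier (GL_group smul)" "\<forall>p\<in>F. flag_action g R' p = R p"
      using flag_orbits_dense[OF R _ F(1)] R' sub by blast
    then show False using F(2) C R' by blast
  qed
  then show "C = topspace flag_space" using sub by (auto simp: topspace_flag_space)
qed


section \<open>Counting greatest vectors\<close>

text \<open>
  If \<open>x\<close> is greatest in \<open>W\<close>, then the vectors of \<open>W\<close> strictly below \<open>x\<close> form a subspace \<open>H\<close>, and translation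
  by \<open>x\<close> injects \<open>H\<close> into its complement in \<open>W\<close>, which consists of the greatest vectors.
\<close>

lemma card_flag_max:
  assumes R: "flag_preorder R" and W: "finite W" "subspace W" "W \<noteq> {0}"
  shows "card W \<le> 2 * card {x \<in> W - {0}. \<forall>v\<in>W. R (v, x)}"
proof -
  have "W \<noteq> {}" using subspace_0[OF W(2)] by blast
  obtain x where x: "x \<in> W" "\<And>v. v \<in> W \<Longrightarrow> R (v, x)"
    using flag_has_max[OF R W(1) \<open>W \<noteq> {}\<close>] by blast
  obtain y where "y \<in> W" "y \<noteq> 0" using W(3) subspace_0[OF W(2)] by blast
  then have x0: "x \<noteq> 0" using x(2) flag_zero[OF R] by blast
  let ?H = "{v \<in> W. \<not> R (x, v)}" and ?M = "{x \<in> W - {0}. \<forall>v\<in>W. R (v, x)}"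
  have H: "subspace ?H" using subspace_flag_below[OF R W(2) x0] .
  have M: "v \<in> ?M" if v: "v \<in> W" "R (x, v)" for v
  proof -
    have "v \<noteq> 0" using v(2) x0 flag_zero[OF R] by blast
    moreover have "R (u, v)" if "u \<in> W" for u using flag_trans[OF R x(2)[OF that] v(2)] .
    ultimately show ?thesis using v(1) by blast
  qed
  have "x + v \<in> ?M" if v: "v \<in> ?H" for v
  proof (rule M)
    show "x + v \<in> W" using v x(1) subspace_add[OF W(2)] by blast
    show "R (x, x + v)"
    proof (rule ccontr)
      assume "\<not> R (x, x + v)"
      then have "x + v \<in> ?H" using \<open>x + v \<in> W\<close> by blast
      then have "x + v - v \<in> ?H" using subspace_diff[OF H _ v] by blast
      then show False using x by simp
    qed
  qed
  then have "card ?H \<le> card ?M"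
    using W(1) by (intro card_inj_on_le[of "\<lambda>v. x + v"]) (auto simp: inj_on_def)
  moreover have "W \<subseteq> ?H \<union> ?M" using M by blast
  then have "card W \<le> card ?H + card ?M"
    by (rule order_trans[OF card_mono card_Un_le, rotated]) (simp add: W(1))
  ultimately show ?thesis by simp
qed

lemma GL_transitive_on_nonzero:
  assumes W: "finite W" "subspace W" and x: "x \<in> W" "x \<noteq> 0" and y: "y \<in> W" "y \<noteq> 0"
  shows "\<exists>g\<in>carrier (GL_group smul). g x = y \<and> g ` W = W"
proof -
  have ext: "\<exists>A. z \<in> A \<and> independent A \<and> span A = W" if z: "z \<in> W" "z \<noteq> 0" for z
  proof -
    have "independent {z}" using z(2) by simp
    then obtain A where A: "{z} \<subseteq> A" "A \<subseteq> W" "independent A" "W \<subseteq> span A"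
      using maximal_independent_subset_extend[of "{z}" W] z(1) by blast
    then have "span A = W" using span_minimal[OF A(2) W(2)] by blast
    then show ?thesis using A by blast
  qed
  obtain A where A: "x \<in> A" "independent A" "span A = W" using ext[OF x] by blast
  obtain B where B: "y \<in> B" "independent B" "span B = W" using ext[OF y] by blast
  have fin: "finite A" "finite B" using A B W(1) span_superset finite_subset by metis+
  have "card A = card B"
    using dim_span_eq_card_independent[OF A(2)] dim_span_eq_card_independent[OF B(2)] A(3) B(3)
    by simp
  then have "card (A - {x}) = card (B - {y})" using A(1) B(1) by simp
  then obtain h where h: "bij_betw h (A - {x}) (B - {y})"
    using fin by (meson finite_Diff finite_same_card_bij)
  then have "bij_betw (h(x := y)) (A - {x}) (B - {y})"
    by (rule bij_betw_cong[THEN iffD1, rotated]) simp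
  then have "bij_betw (h(x := y)) (A - {x} \<union> {x}) (B - {y} \<union> {(h(x := y)) x})"
    by (intro notIn_Un_bij_betw) auto
  then have hb: "bij_betw (h(x := y)) A B" using A(1) B(1) by (simp add: insert_absorb)
  obtain g where g: "g \<in> carrier (GL_group smul)" "\<forall>a\<in>A. g a = (h(x := y)) a"
    using independent_bij_extends_to_automorphism[OF A(2) B(2) _ hb] A(3) B(3) by auto
  interpret vector_space_pair smul smul by unfold_locales
  have "g ` A = B" using g(2) hb by (auto simp: bij_betw_def cong: image_cong)
  then have "g ` W = W" using linear_span_image[OF GL_groupD(1)[OF g(1)], of A] A(3) B(3) by simp
  moreover have "g x = y" using g(2) A(1) by simp
  ultimately show ?thesis using g(1) by blast
qed

end


section \<open>A flag preorder without a greatest class\<close>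

locale finite_field_vector_space_basis = finite_field_vector_space smul
  for smul :: "'k::{field, finite} \<Rightarrow> 'v::ab_group_add \<Rightarrow> 'v" +
  fixes b :: "nat \<Rightarrow> 'v"
  assumes inj_basis: "inj b" and independent_basis: "independent (range b)"
    and span_basis: "span (range b) = UNIV"
begin

definition V :: "nat \<Rightarrow> 'v set"
  where "V n = span (b ` {..<n})"

lemma subspace_V: "subspace (V n)" and finite_V: "finite (V n)"
  by (simp_all add: V_def finite_span)

lemma V_mono: "m \<le> n \<Longrightarrow> V m \<subseteq> V n"
  unfolding V_def by (intro span_mono) auto

lemma V_exhausts: "\<exists>n. v \<in> V n"
proof -
  have "v \<in> span (range b)" by (simp add: span_basis)
  then have "v \<in> span (\<Union>n. b ` {..<n})"
    by (rule subsetD[OF span_mono, rotated]) auto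
  then show ?thesis
  proof (induction rule: span_induct_alt)
    case base
    then show ?case using subspace_0[OF subspace_V] by blast
  next
    case (step c x y)
    then obtain m n where "x \<in> b ` {..<m}" "y \<in> V n" by blast
    then have "x \<in> V (max m n)" "y \<in> V (max m n)"
      using V_mono[of m "max m n"] V_mono[of n "max m n"] span_base[of x "b ` {..<m}"]
      unfolding V_def[symmetric] by auto
    then show ?case using subspace_add[OF subspace_V] subspace_scale[OF subspace_V] by blast
  qed
qed

lemma basis_notin_V: "b n \<notin> V n"
proof
  assume "b n \<in> V n"
  moreover have "b ` {..<n} \<subseteq> range b - {b n}" using inj_basis by (auto simp: inj_eq)
  ultimately have "b n \<in> span (range b - {b n})" unfolding V_def using span_mono by blast
  then show False using independent_basis unfolding dependent_def by blast
qed

definition level_preorder :: "'v \<times> 'v \<Rightarrow> bool"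
  where "level_preorder = (\<lambda>(u, v). \<forall>n. v \<in> V n \<longrightarrow> u \<in> V n)"

lemma flag_preorder_level: "flag_preorder level_preorder"
  unfolding flag_preorder_def level_preorder_def prod.case
proof (intro conjI allI impI)
  fix u v
  show "(\<forall>n. v \<in> V n \<longrightarrow> u \<in> V n) \<or> (\<forall>n. u \<in> V n \<longrightarrow> v \<in> V n)"
    by (meson V_mono linear subsetD)
next
  fix u w assume w: "w \<noteq> 0" and uw: "\<forall>n. w \<in> V n \<longrightarrow> u \<in> V n"
  define n where "n = (LEAST n. w \<in> V n)"
  have wn: "w \<in> V n" unfolding n_def using V_exhausts by (rule LeastI_ex)
  have "n \<noteq> 0" using wn w by (auto simp: V_def intro: ccontr)
  then obtain m where m: "n = Suc m" using not0_implies_Suc by blast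
  have wm: "w \<notin> V m" using not_less_Least[of m "\<lambda>n. w \<in> V n"] m n_def by auto
  \<comment> \<open>Both \<open>u\<close> and \<open>w\<close> are, modulo \<open>V m\<close>, multiples of \<open>b m\<close>, and that of \<open>w\<close> is nonzero.\<close>
  have V_Suc: "\<exists>c. v - smul c (b m) \<in> V m" if "v \<in> V n" for v
    using that unfolding m V_def lessThan_Suc image_insert span_insert by simp
  obtain c where c: "w - smul c (b m) \<in> V m" using V_Suc[OF wn] by blast
  obtain a where a: "u - smul a (b m) \<in> V m" using V_Suc uw wn by blast
  have c0: "c \<noteq> 0" using c wm by auto
  have "u - smul a (b m) - smul (a / c) (w - smul c (b m)) \<in> V m"
    using a c subspace_diff[OF subspace_V] subspace_scale[OF subspace_V] by blast
  then have "u - smul (a / c) w \<in> V m"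
    using c0 by (simp add: scale_right_diff_distrib)
  then show "\<exists>c. \<not> (\<forall>n. u - smul c w \<in> V n \<longrightarrow> w \<in> V n)" using wm by blast
next
  fix u assume "\<forall>n. 0 \<in> V n \<longrightarrow> u \<in> V n"
  then have "u \<in> V 0" using subspace_0[OF subspace_V] by blast
  then show "u = 0" by (simp add: V_def)
qed (use subspace_add[OF subspace_V] subspace_scale[OF subspace_V] in blast)+

lemma level_preorder_unbounded: "\<exists>v. \<not> level_preorder (v, x)"
  using V_exhausts[of x] basis_notin_V unfolding level_preorder_def by auto


section \<open>The generic orbit is not conull\<close>

lemma generic_orbit_not_conull:
  fixes M :: "'m topology"
  assumes M: "universal_minimal_flow (GL_group smul) (GL_topology smul) M \<phi>"
    and \<mu>: "invariant_borel_prob (GL_group smul) M \<phi> \<mu>"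
    and S: "generic_orbit (GL_group smul) M \<phi> S"
  shows "\<not> (AE x in \<mu>. x \<in> S)"
proof
  assume AE: "AE x in \<mu>. x \<in> S"
  let ?G = "GL_group smul" and ?T = "GL_topology smul"
  have T: "topspace ?T = carrier ?G" by (rule topspace_GL_topology)
  have mM: "minimal_flow ?G ?T M \<phi>" using M by (simp add: universal_minimal_flow_def)
  then have fM: "flow ?G ?T M \<phi>" by (simp add: minimal_flow_def)
  interpret A: group_action ?G "topspace M" \<phi> using fM by (simp add: flow_def)
  have mN: "minimal_flow ?G ?T flag_space flag_action"
    using flag_minimal_flow flag_preorder_level by blast
  obtain f where f: "flow_map ?G M \<phi> flag_space flag_action f"
    using universal_minimal_flowD[OF T M mN] by blast
  have cf: "continuous_map M flag_space f"
    and eqv: "\<And>g p. g \<in> carrier ?G \<Longrightarrow> p \<in> topspace M \<Longrightarrow> f (\<phi> g p) = flag_action g (f p)"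
    using f by (auto simp: flow_map_def)
  have fp: "flag_preorder (f p)" if "p \<in> topspace M" for p
    using continuous_map_image_subset_topspace[OF cf] that topspace_flag_space by blast
  have inv_f: "f (\<phi> g p) (g u, g v) = f p (u, v)"
    if g: "g \<in> carrier ?G" and p: "p \<in> topspace M" for g p u v
    using GL_groupD(2)[OF g] by (simp add: eqv[OF g p] flag_action_apply[OF fp[OF p]] bij_is_inj)

  \<comment> \<open>the event that no vector of \<open>W\<close> lies strictly above \<open>x\<close> in the preorder \<open>f p\<close>\<close>
  define Q where "Q W x = {p \<in> topspace M. \<forall>v\<in>W. f p (v, x)}" for W x
  have clQ: "closedin M (Q W x)" for W x
  proof -
    have "openin M (\<Union>v\<in>W. {p \<in> topspace M. f p \<in> {R. flag_preorder R \<and> R (v, x) = False}})"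
      using openin_continuous_map_preimage[OF cf openin_flag_space_point] by (intro openin_Union) blast
    moreover have "(\<Union>v\<in>W. {p \<in> topspace M. f p \<in> {R. flag_preorder R \<and> R (v, x) = False}})
        = topspace M - Q W x"
      using fp by (auto simp: Q_def)
    moreover have "Q W x \<subseteq> topspace M" by (auto simp: Q_def)
    ultimately show ?thesis by (simp add: closedin_def)
  qed

  have "S \<inter> \<Union>(range (Q UNIV)) = {}"
  proof (rule generic_orbit_disjoint_invariant_fsigma[OF mM T S])
    have "(\<Union>n. V n) = UNIV" using V_exhausts by blast
    then have "countable (UNIV :: 'v set)"
      by (metis countable_UN countable_finite finite_V countableI_type)
    then show "countable (range (Q UNIV))" by simp
    show "closedin M F" if "F \<in> range (Q UNIV)" for F using that clQ by blast
    have "level_preorder \<in> f ` topspace M"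
      using flow_map_surj[OF mM mN f] flag_preorder_level topspace_flag_space by simp
    then obtain p where p: "p \<in> topspace M" "f p = level_preorder" by auto
    then have "p \<notin> Q UNIV x" for x using level_preorder_unbounded[of x] by (simp add: Q_def)
    then show "\<Union>(range (Q UNIV)) \<noteq> topspace M" using p(1) by blast
    fix g p assume g: "g \<in> carrier ?G" and "p \<in> \<Union>(range (Q UNIV))"
    then obtain x where p: "p \<in> topspace M" "\<And>v. f p (v, x)" by (auto simp: Q_def)
    have "f (\<phi> g p) (v, g x)" for v
      using inv_f[OF g p(1), of "inv_fun g v" x] p(2) GL_groupD(2)[OF g]
      by (simp add: bij_is_surj surj_f_inv_f)
    moreover have "\<phi> g p \<in> topspace M" using A.element_image[OF g p(1) refl] .
    ultimately show "\<phi> g p \<in> \<Union>(range (Q UNIV))" by (auto simp: Q_def)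
  qed

  interpret prob_space \<mu> using \<mu> by (simp add: invariant_borel_prob_def)
  have sp: "space \<mu> = topspace M" and st: "sets \<mu> = sigma_sets (topspace M) {U. openin M U}"
    and dist: "\<And>g. g \<in> carrier ?G \<Longrightarrow> distr \<mu> \<mu> (\<phi> g) = \<mu>"
    using \<mu> by (auto simp: invariant_borel_prob_def)
  have op: "U \<in> sets \<mu>" if "openin M U" for U unfolding st using that by blast
  have mQ: "Q W x \<in> sets \<mu>" for W x
  proof -
    have "topspace M - (topspace M - Q W x) \<in> sets \<mu>"
      unfolding sp[symmetric] by (rule sets.compl_sets, rule op) (use clQ sp in auto)
    moreover have "topspace M - (topspace M - Q W x) = Q W x" by (auto simp: Q_def)
    ultimately show ?thesis by simp
  qed
  have m\<phi>: "\<phi> g \<in> measurable \<mu> \<mu>" if g: "g \<in> carrier ?G" for g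
  proof (rule measurable_sigma_sets[OF st])
    have cm: "continuous_map M M (\<phi> g)" using flow_continuous_map[OF fM T g] .
    show "{U. openin M U} \<subseteq> Pow (topspace M)" using openin_subset by blast
    show "\<phi> g \<in> space \<mu> \<rightarrow> topspace M" using cm by (auto simp: sp continuous_map_def)
    show "\<phi> g -` U \<inter> space \<mu> \<in> sets \<mu>" if "U \<in> {U. openin M U}" for U
    proof -
      have "openin M {p \<in> topspace M. \<phi> g p \<in> U}"
        using openin_continuous_map_preimage[OF cm] that by simp
      moreover have "{p \<in> topspace M. \<phi> g p \<in> U} = \<phi> g -` U \<inter> space \<mu>" by (auto simp: sp)
      ultimately show ?thesis using op by metis
    qed
  qed
  have sym: "prob (Q W (g x)) = prob (Q W x)" if g: "g \<in> carrier ?G" and W: "g ` W = W" for g x W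
  proof -
    have "\<phi> g -` Q W (g x) \<inter> space \<mu> = Q W x"
    proof -
      have "(\<forall>v\<in>W. f (\<phi> g p) (v, g x)) \<longleftrightarrow> (\<forall>v\<in>W. f p (v, x))" if "p \<in> topspace M" for p
      proof -
        have "(\<forall>v\<in>W. f (\<phi> g p) (v, g x)) \<longleftrightarrow> (\<forall>v\<in>g ` W. f (\<phi> g p) (v, g x))" by (simp only: W)
        also have "\<dots> \<longleftrightarrow> (\<forall>v\<in>W. f p (v, x))" by (simp add: inv_f[OF g that])
        finally show ?thesis .
      qed
      then show ?thesis using A.element_image[OF g _ refl] by (auto simp: Q_def sp)
    qed
    then show ?thesis
      using measure_distr[OF m\<phi>[OF g] mQ, of W "g x"] by (simp add: dist[OF g])
  qed

  \<comment> \<open>The subspaces \<open>V (Suc n)\<close> all contain the nonzero vector \<open>x\<close>.\<close>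
  define x where "x = b 0"
  have half: "1 / 2 \<le> prob (Q (V (Suc n)) x)" for n
  proof -
    define W where "W = V (Suc n)"
    have W: "finite W" "subspace W" by (simp_all add: W_def finite_V subspace_V)
    have xW: "x \<in> W" by (auto simp: W_def V_def x_def intro: span_base)
    have x0: "x \<noteq> 0" using basis_notin_V[of 0] by (simp add: x_def V_def)
    have same: "prob (Q W y) = prob (Q W x)" if "y \<in> W - {0}" for y
      using GL_transitive_on_nonzero[OF W xW x0, of y] that sym by auto
    have count: "real (card W) / 2 \<le> (\<Sum>y\<in>W - {0}. indicator (Q W y) p)" if p: "p \<in> space \<mu>" for p
    proof -
      have "{y \<in> W - {0}. \<forall>v\<in>W. f p (v, y)} = {y \<in> W - {0}. p \<in> Q W y}"
        using p by (auto simp: Q_def sp)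
      moreover have "W \<noteq> {0}" using xW x0 by blast
      ultimately have "card W \<le> 2 * card {y \<in> W - {0}. p \<in> Q W y}"
        using card_flag_max[OF fp W, of p] p sp by simp
      moreover have "(\<Sum>y\<in>W - {0}. indicator (Q W y) p) = real (card {y \<in> W - {0}. p \<in> Q W y})"
        using W(1) by (simp add: indicator_def sum.If_cases Int_def)
      ultimately show ?thesis by simp
    qed
    have int: "integrable \<mu> (indicator (Q W y) :: 'm \<Rightarrow> real)" for y
      by (intro integrable_real_indicator mQ) (simp add: emeasure_eq_measure)
    then have "integrable \<mu> (\<lambda>p. \<Sum>y\<in>W - {0}. indicator (Q W y) p :: real)"
      by (intro Bochner_Integration.integrable_sum)
    \<comment> \<open>Integrate the count over \<open>M\<close>: the expected number of greatest vectors is a sum of equal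
      probabilities.\<close>
    with count have "real (card W) / 2 \<le> (\<integral>p. (\<Sum>y\<in>W - {0}. indicator (Q W y) p) \<partial>\<mu>)"
      by (intro integral_ge_const AE_I2)
    also have "\<dots> = (\<Sum>y\<in>W - {0}. prob (Q W y))"
      using mQ int by (simp add: Bochner_Integration.integral_sum)
    also have "\<dots> = real (card (W - {0})) * prob (Q W x)" using same by simp
    also have "\<dots> \<le> real (card W) * prob (Q W x)"
      using W(1) by (intro mult_right_mono) (auto intro: card_mono)
    finally have "real (card W) * (1 / 2) \<le> real (card W) * prob (Q W x)" by simp
    moreover have "0 < real (card W)" using W(1) xW by (auto simp: card_gt_0_iff)
    ultimately show ?thesis unfolding W_def[symmetric] by (rule mult_left_le_imp_le)
  qed
  have "(\<Inter>n. Q (V (Suc n)) x) = Q UNIV x"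
  proof
    show "(\<Inter>n. Q (V (Suc n)) x) \<subseteq> Q UNIV x"
    proof
      fix p assume p: "p \<in> (\<Inter>n. Q (V (Suc n)) x)"
      have "f p (v, x)" for v
      proof -
        obtain n where "v \<in> V n" using V_exhausts by blast
        then have "v \<in> V (Suc n)" using V_mono[of n "Suc n"] by auto
        then show ?thesis using p by (auto simp: Q_def)
      qed
      then show "p \<in> Q UNIV x" using p by (auto simp: Q_def)
    qed
  qed (auto simp: Q_def)
  moreover have "decseq (\<lambda>n. Q (V (Suc n)) x)"
    unfolding decseq_def Q_def using V_mono Suc_le_mono by blast
  ultimately have "(\<lambda>n. prob (Q (V (Suc n)) x)) \<longlonglongrightarrow> prob (Q UNIV x)"
    using finite_Lim_measure_decseq[of "\<lambda>n. Q (V (Suc n)) x"] mQ by auto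
  then have "1 / 2 \<le> prob (Q UNIV x)" by (rule LIMSEQ_le_const) (use half in blast)
  moreover have "AE p in \<mu>. p \<notin> Q UNIV x"
    using AE by (rule AE_mp) (use \<open>S \<inter> \<Union>(range (Q UNIV)) = {}\<close> in auto)
  then have "prob (Q UNIV x) = 0" using prob_eq_0[OF mQ] by simp
  ultimately show False by simp
qed

end

theorem theorem1p2:
  fixes smul :: "'k::{field, finite} \<Rightarrow> 'v::ab_group_add \<Rightarrow> 'v"
    and M :: "'m topology" and \<phi> :: "('v \<Rightarrow> 'v) \<Rightarrow> 'm \<Rightarrow> 'm"
    and \<mu> :: "'m measure" and S :: "'m set"
  assumes "vector_space smul" and "countably_infinite_dimensional smul"
    and "universal_minimal_flow (GL_group smul) (GL_topology smul) M \<phi>"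
    and "invariant_borel_prob (GL_group smul) M \<phi> \<mu>"
    and "generic_orbit (GL_group smul) M \<phi> S"
  shows "\<not> (AE x in \<mu>. x \<in> S)"
proof -
  interpret vector_space smul by fact
  obtain B where B: "\<not> dependent B" "span B = UNIV" "infinite B" "countable B"
    using assms(2) unfolding countably_infinite_dimensional_def by blast
  have "bij_betw (from_nat_into B) UNIV B" using B by (intro bij_betw_from_nat_into)
  then interpret finite_field_vector_space_basis smul "from_nat_into B"
    using B by unfold_locales (auto simp: bij_betw_def)
  show ?thesis using assms(3-5) by (rule generic_orbit_not_conull)
qed

end
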